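(* Let $0\le h\le k$. Then \[\psi(h,k)=\left(\prod_{\ell=h}^{k-1} \big(S^{-a(\ell,k-1)}(\psi(0,k-1))\big)^2\right)\cdot k,\] where the product denotes concatenation in increasing order of $\ell$ (and is empty when $h=k$).
   Context: $\mathbb{N}=\{0,1,2,\ldots\}$ is an alphabet with its usual order; $x\cdot y$ denotes concatenation and $u^2=uu$. An overlap is a word $cxcxc$ with $c$ a letter and $x$ a possibly empty word; overlap-free means having no overlap as a factor. Lexicographic order: $x\le y$ if $x$ is a prefix of $y$ or $x=wcx'$, $y=wdy'$ with letters $c<d$. For $0\le h\le k$, $\psi(h,k)$ is the lexicographically least overlap-free word over $\mathbb{N}$ that starts with $h$ and ends with $k$, and $a(h,k)=|\psi(h,k)|$. $S$ is the left cyclic shift $S(cx)=xc$ ($c$ a letter), $S^{-1}$ its inverse, and $S^{-n}$ the $n$-fold iterate of $S^{-1}$. *)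

theory Defs
  imports Main "HOL-Library.Sublist" "HOL-Library.List_Lexorder"
begin

definition is_overlap :: "'a list \<Rightarrow> bool" where
  "is_overlap w \<longleftrightarrow> (\<exists>c x. w = [c] @ x @ [c] @ x @ [c])"

definition overlap_free :: "'a list \<Rightarrow> bool" where
  "overlap_free w \<longleftrightarrow> \<not> (\<exists>u. sublist u w \<and> is_overlap u)"

text \<open>
  The order on lists is the lexicographic order of \<^theory>\<open>HOL-Library.List_Lexorder\<close>,
  in which a prefix precedes its extensions. It is not well-founded on words over
  \<^typ>\<open>nat\<close>, so the existence of a least element below is not automatic.
\<close>

definition psi :: "nat \<Rightarrow> nat \<Rightarrow> nat list" where
  "psi h k = (LEAST w. overlap_free w \<and> w \<noteq> [] \<and> hd w = h \<and> last w = k)"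

definition psi_length :: "nat \<Rightarrow> nat \<Rightarrow> nat" where
  "psi_length h k = length (psi h k)"

text \<open>
  The left cyclic shift is \<^const>\<open>rotate1\<close>, here taken to fix the empty word; it is a bijection,
  so \<^const>\<open>inv\<close> gives its two-sided inverse.
\<close>

lemma bij_rotate1: "bij (rotate1 :: 'a list \<Rightarrow> 'a list)"
proof (rule bijI)
  show "inj (rotate1 :: 'a list \<Rightarrow> 'a list)"
    by (rule inj_rotate1)
  show "surj (rotate1 :: 'a list \<Rightarrow> 'a list)"
    by (rule surj_rotate1)
qed

abbreviation shift_inv :: "'a list \<Rightarrow> 'a list" where
  "shift_inv \<equiv> inv rotate1"

lemma shift_inv_snoc: "shift_inv (x @ [c]) = c # x"
  by (rule inv_f_eq) (simp_all add: inj_rotate1)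

definition square :: "'a list \<Rightarrow> 'a list" where
  "square u = u @ u"

end

theory Submission imports Defs begin

text \<open>
  Let \<open>w(h,k)\<close> be the right-hand side, built recursively. It is greedy: replacing a letter other
  than the first by a smaller one creates an overlap that ends there, so nothing below \<open>w(h,k)\<close>
  with the same first and last letter is overlap-free. Overlap-freeness is proved by induction on
  \<open>k\<close>, more generally for the product of the squared blocks over any increasing list of indices.
  Such a product, cut at the occurrences of \<open>k - 1\<close>, falls into words covered by the induction
  hypothesis. An overlap that meets some \<open>k - 1\<close> matches two occurrences of \<open>k - 1\<close>; since the
  block with index \<open>l\<close> starts with \<open>l\<close> and ends with \<open>k - 1 - l\<close>, blocks with different indices
  differ at both ends, and this keeps the matching range too short.
\<close>

section \<open>Overlaps\<close>

lemma overlap_free_sublist: "overlap_free w \<Longrightarrow> sublist u w \<Longrightarrow> overlap_free u"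
  unfolding overlap_free_def using sublist_order.order_trans by blast

lemma not_overlap_free_square_hd:
  assumes "r \<noteq> []"
  shows "\<not> overlap_free (r @ r @ [hd r])"
proof -
  obtain c x where "r = c # x" using assms by (cases r) auto
  then have "is_overlap (r @ r @ [hd r])" by (auto simp: is_overlap_def)
  then show ?thesis unfolding overlap_free_def by blast
qed

lemma is_overlap_snocD:
  assumes "is_overlap (u @ [c])"
  shows "c \<in> set u"
  using assms by (auto simp: is_overlap_def simp flip: append_assoc append_Cons)

text \<open>The last letter of an overlap already occurs earlier in it, so no overlap ends in the
  fresh \<open>y\<close>.\<close>

lemma overlap_free_snoc_fresh:
  assumes "overlap_free X" "y \<notin> set X"
  shows "overlap_free (X @ [y])"
  unfolding overlap_free_def
proof clarify
  fix u assume u: "sublist u (X @ [y])" and ov: "is_overlap u"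
  from u have "sublist u X \<or> suffix u (X @ [y])"
    by (simp add: sublist_append) (auto simp: prefix_Cons sublist_Cons_right suffix_def)
  then show False
  proof
    assume "sublist u X"
    with assms(1) ov show False by (auto simp: overlap_free_def)
  next
    assume "suffix u (X @ [y])"
    moreover have "u \<noteq> []" using ov by (auto simp: is_overlap_def)
    ultimately obtain u' where "u = u' @ [y]" "suffix u' X" by (auto simp: suffix_snoc)
    with is_overlap_snocD ov assms(2) show False
      by (metis set_mono_suffix subsetD)
  qed
qed

text \<open>A factor without \<open>z\<close> cannot straddle the displayed \<open>z\<close>. This
  serves to cut words at successive occurrences of a letter.\<close>

lemma sublist_avoiding:
  assumes "sublist u (X @ z # Y)" "z \<notin> set u"
  shows "sublist u X \<or> sublist u Y"
proof -
  from assms(1) obtain a b where ab: "X @ z # Y = a @ u @ b" by (auto simp: sublist_def)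
  then have "X @ z # Y = (a @ u) @ b" by simp
  then consider s where "a @ u = X @ s" "s @ b = z # Y" | s where "X = (a @ u) @ s"
    using append_eq_append_conv2[of X "z # Y" "a @ u" b] by metis
  then show ?thesis
  proof cases
    case 1
    show ?thesis
    proof (cases s)
      case Nil
      then show ?thesis using 1 by (metis append.right_neutral suffixI suffix_imp_sublist)
    next
      case (Cons y s')
      then have "a @ u = X @ z # s'" "Y = s' @ b" using 1 by auto
      then have "suffix u s'" using assms(2)
        by (auto simp: append_eq_append_conv2 append_eq_Cons_conv suffix_def)
      then show ?thesis using \<open>Y = s' @ b\<close> by (metis sublist_append suffix_imp_sublist)
    qed
  next
    case 2
    then show ?thesis by (metis append_assoc sublist_appendI)
  qed
qed

lemma occurrence_cases:
  assumes "X @ z # Y = X0 @ z # Y0" "z \<notin> set X0"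
  obtains "X = X0" "Y = Y0" | X' where "X = X0 @ z # X'" "Y0 = X' @ z # Y"
  using assms by (auto simp: append_eq_append_conv2 Cons_eq_append_conv append_eq_Cons_conv)

text \<open>The words \<open>u\<close> and \<open>v\<close> delimit the range on which the overlap matches two occurrences of \<open>z\<close>.\<close>

lemma overlap_matches_occurrences:
  assumes "sublist w W" "is_overlap w" "z \<in> set w"
  obtains A B A' B' u v where "W = A @ z # B" "W = A' @ z # B'" "suffix u A" "suffix u A'"
    "prefix v B" "prefix v B'" "length A < length A'" "length A' = length A + length u + length v"
proof -
  obtain c x where w: "w = (c # x) @ (c # x) @ [c]" using assms(2) by (auto simp: is_overlap_def)
  then have "z \<in> set (c # x)" using assms(3) by auto
  then obtain y1 y2 where y: "c # x = y1 @ z # y2" by (metis split_list)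
  obtain a b where W: "W = a @ w @ b" using assms(1) by (auto simp: sublist_def)
  obtain r where r: "y1 @ z # y2 = c # r" using y by metis
  \<comment> \<open>Take the copies of \<open>z\<close> in the two periods of the overlap. They
    match on \<open>y1\<close> to the left and on \<open>y2\<close> to the right. The closing
    \<open>c\<close> lengthens the right match by one, which compensates for \<open>z\<close>
    itself, so the shift equals \<open>length u + length v\<close> exactly.\<close>
  show ?thesis
  proof (rule that[of "a @ y1" "y2 @ y1 @ z # y2 @ c # b" "a @ y1 @ z # y2 @ y1" "y2 @ c # b"
        y1 "y2 @ [c]"])
    have "W = a @ (y1 @ z # y2) @ (y1 @ z # y2) @ c # b" using W w y by simp
    then show "W = (a @ y1) @ z # y2 @ y1 @ z # y2 @ c # b"
      "W = (a @ y1 @ z # y2 @ y1) @ z # y2 @ c # b" by simp_all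
    have "y2 @ y1 @ z # y2 @ c # b = y2 @ (y1 @ z # y2) @ c # b" by simp
    also have "\<dots> = (y2 @ [c]) @ r @ c # b" by (subst r) simp
    finally show "prefix (y2 @ [c]) (y2 @ y1 @ z # y2 @ c # b)" by (metis prefixI)
  qed (auto simp: suffix_def prefix_def)
qed

text \<open>A longer \<open>v\<close> would continue \<open>T\<close> by a letter that heads both
  \<open>X\<close> and \<open>Y\<close>.\<close>

lemma common_prefix_le:
  assumes "prefix v (T @ X)" "prefix v (T @ Y)" "X = [] \<or> Y = [] \<or> hd X \<noteq> hd Y"
  shows "length v \<le> length T"
proof (rule ccontr)
  assume "\<not> length v \<le> length T"
  then obtain v' where "v = T @ v'" "v' \<noteq> []"
    using assms(1) by (auto simp: prefix_append dest: prefix_length_le)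
  then show False using assms by (cases v'; cases X; cases Y) auto
qed

lemma common_suffix_le:
  assumes "suffix u (X @ T)" "suffix u (Y @ T)" "X = [] \<or> Y = [] \<or> last X \<noteq> last Y"
  shows "length u \<le> length T"
  using common_prefix_le[of "rev u" "rev T" "rev X" "rev Y"] assms
  by (auto simp: suffix_to_prefix hd_rev)

section \<open>Products of squared blocks\<close>

text \<open>Arbitrary index lists are allowed because the induction for overlap-freeness meets lists
  such as \<open>[0..<j] @ [a..<k]\<close>. The instances \<open>[l..<k]\<close> and
  \<open>[0..<l]\<close> give the two halves of a block of the next level.\<close>

primrec gword :: "nat \<Rightarrow> nat list \<Rightarrow> nat list" where
  "gword 0 A = [0]"
| "gword (Suc k) A =
    concat (map (\<lambda>l. square (gword k [l..<k] @ butlast (gword k [0..<l]))) A) @ [Suc k]"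

text \<open>
  In the paper's notation, \<open>suf k l\<close> is \<open>\<psi>(l,k)\<close>, \<open>pre k l\<close> is the prefix that completes it to
  \<open>\<psi>(0,k)\<close>, and \<open>rot k l\<close> is the conjugate of \<open>\<psi>(0,k)\<close> starting with \<open>\<psi>(l,k)\<close>.
\<close>

definition suf :: "nat \<Rightarrow> nat \<Rightarrow> nat list" where
  "suf k l = gword k [l..<k]"

definition pre :: "nat \<Rightarrow> nat \<Rightarrow> nat list" where
  "pre k l = butlast (gword k [0..<l])"

definition rot :: "nat \<Rightarrow> nat \<Rightarrow> nat list" where
  "rot k l = suf k l @ pre k l"

definition squares :: "nat \<Rightarrow> nat list \<Rightarrow> nat list" where
  "squares k A = concat (map (\<lambda>l. square (rot k l)) A)"

lemma gword_Suc: "gword (Suc k) A = squares k A @ [Suc k]"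
  by (simp add: squares_def rot_def suf_def pre_def)

declare gword.simps(2) [simp del]

lemma squares_simps [simp]:
  "squares k [] = []"
  "squares k (l # A) = rot k l @ rot k l @ squares k A"
  "squares k (A @ B) = squares k A @ squares k B"
  by (simp_all add: squares_def square_def)

lemma gword_snoc: "gword k A = butlast (gword k A) @ [k]"
  by (cases k) (simp_all add: gword_Suc)

lemma suf_snoc: "suf k l = butlast (suf k l) @ [k]"
  unfolding suf_def by (rule gword_snoc)

lemma rot_eq: "rot k l = butlast (suf k l) @ k # pre k l"
  using suf_snoc[of k l] unfolding rot_def by (metis append.assoc append_Cons append_Nil)

lemma suf_nonempty: "suf k l \<noteq> []"
  by (metis suf_snoc snoc_eq_iff_butlast)

lemma suf_self: "suf k k = [k]"
  by (cases k) (simp_all add: suf_def gword_Suc)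

lemma pre_0 [simp]: "pre k 0 = []"
  by (cases k) (simp_all add: pre_def gword_Suc)

lemma pre_Suc: "pre (Suc k) l = squares k [0..<l]"
  by (simp add: pre_def gword_Suc)

lemma pre_append_gword: "l \<le> k \<Longrightarrow> pre k l @ gword k A = gword k ([0..<l] @ A)"
  by (cases k) (simp_all add: gword_Suc pre_Suc)

lemma pre_suf: "l \<le> k \<Longrightarrow> pre k l @ suf k l = suf k 0"
  by (metis le_add_diff_inverse le0 pre_append_gword suf_def upt_add_eq_append)

lemma hd_suf: "l \<le> k \<Longrightarrow> hd (suf k l) = l"
proof (induction k)
  case 0
  then show ?case by (simp add: suf_self)
next
  case (Suc k)
  show ?case
  proof (cases "l = Suc k")
    case False
    then have "[l..<Suc k] = l # [Suc l..<Suc k]" "l \<le> k" using Suc.prems by (auto simp: upt_conv_Cons)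
    then have "suf (Suc k) l = suf k l @ pre k l @ rot k l @ squares k [Suc l..<Suc k] @ [Suc k]"
      by (simp add: suf_def [of "Suc k"] gword_Suc rot_def)
    then show ?thesis using Suc.IH \<open>l \<le> k\<close> suf_nonempty by simp
  qed (simp add: suf_self)
qed

text \<open>The added \<open>k\<close> supplies the value for \<open>l = 0\<close>, where
  \<open>pre k 0\<close> is empty. Otherwise \<open>pre (Suc k) (Suc j)\<close> ends with
  \<open>rot k j\<close>, hence with \<open>k # pre k j\<close>, and the difference is
  unchanged.\<close>

lemma last_pre: "l \<le> k \<Longrightarrow> last (k # pre k l) = k - l"
proof (induction k arbitrary: l)
  case 0
  then show ?case by simp
next
  case (Suc k)
  show ?case
  proof (cases l)
    case (Suc j)
    have "pre (Suc k) l = (squares k [0..<j] @ rot k j @ butlast (suf k j)) @ k # pre k j"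
      unfolding Suc pre_Suc by (simp add: rot_def) (metis append_assoc append_Cons append_Nil suf_snoc)
    then have "last (Suc k # pre (Suc k) l) = last (k # pre k j)"
      by (metis append_is_Nil_conv last.simps last_appendR list.distinct(1))
    then show ?thesis using Suc.IH[of j] Suc.prems Suc by simp
  qed simp
qed

lemma set_gword: "set (gword k A) \<subseteq> {..k}"
proof (induction k arbitrary: A)
  case (Suc k)
  have "set (rot k l) \<subseteq> {..k}" for l
    using Suc.IH[of "[l..<k]"] Suc.IH[of "[0..<l]"]
    by (auto simp: rot_def suf_def pre_def dest!: in_set_butlastD)
  then have "set (squares k A) \<subseteq> {..k}" by (auto simp: squares_def square_def)
  then show ?case by (auto simp: gword_Suc)
qed simp

text \<open>Thus \<open>k\<close> occurs in \<open>gword k A\<close> only at the end, and in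
  \<open>rot k l\<close> only at the seam between its two halves.\<close>

lemma set_butlast_gword: "set (butlast (gword k A)) \<subseteq> {..<k}"
proof (cases k)
  case (Suc j)
  have "set (rot j l) \<subseteq> {..j}" for l
    using set_gword[of j "[l..<j]"] set_gword[of j "[0..<l]"]
    by (auto simp: rot_def suf_def pre_def dest!: in_set_butlastD)
  then have "set (squares j A) \<subseteq> {..j}" by (auto simp: squares_def square_def)
  then show ?thesis by (auto simp: Suc gword_Suc less_Suc_eq_le)
qed simp

lemma hd_gword_Suc:
  assumes "set A \<subseteq> {..k}"
  shows "hd (gword (Suc k) A) = hd (A @ [Suc k])"
proof (cases A)
  case (Cons a B)
  then show ?thesis using assms by (simp add: gword_Suc rot_def suf_nonempty hd_suf)
qed (simp add: gword_Suc)

lemma last_rot: "l \<le> k \<Longrightarrow> last (rot k l) = k - l"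
  using last_pre[of l k] suf_snoc[of k l]
  by (cases "pre k l = []") (auto simp: rot_def, metis last_snoc)

lemma last_squares:
  assumes "set A \<subseteq> {..k}" "A \<noteq> []"
  shows "last (squares k A) = k - last A"
proof -
  obtain B a where A: "A = B @ [a]" using assms(2) by (metis rev_exhaust)
  have "rot k a \<noteq> []" by (simp add: rot_def suf_nonempty)
  then show ?thesis using A assms last_rot by simp
qed

section \<open>Greediness\<close>

text \<open>Only the failure of smaller letters is recorded; that the chosen letters themselves
  create no overlap is proved separately. In this form the property passes to concatenations and
  survives extending \<open>s\<close> to the left.\<close>

definition greedy_after :: "nat list \<Rightarrow> nat list \<Rightarrow> bool" where
  "greedy_after s y \<longleftrightarrow> (\<forall>t d y' c. y = t @ d # y' \<longrightarrow> c < d \<longrightarrow> \<not> overlap_free (s @ t @ [c]))"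

lemma greedy_after_append:
  assumes "greedy_after s y" "greedy_after (s @ y) y'"
  shows "greedy_after s (y @ y')"
  unfolding greedy_after_def
proof (intro allI impI)
  fix t d r c assume eq: "y @ y' = t @ d # r" and "c < (d::nat)"
  from eq consider t' where "t = y @ t'" "y' = t' @ d # r" | r' where "y = t @ d # r'"
    by (auto simp: append_eq_append_conv2 append_eq_Cons_conv)
  then show "\<not> overlap_free (s @ t @ [c])"
  proof cases
    case 1
    then show ?thesis using assms(2) \<open>c < d\<close> by (auto simp: greedy_after_def)
  next
    case 2
    then show ?thesis using assms(1) \<open>c < d\<close> by (auto simp: greedy_after_def)
  qed
qed

lemma greedy_after_appendD1: "greedy_after s (y @ y') \<Longrightarrow> greedy_after s y"
  by (fastforce simp: greedy_after_def)

lemma greedy_after_appendD2: "greedy_after s (y @ y') \<Longrightarrow> greedy_after (s @ y) y'"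
  unfolding greedy_after_def by (metis append_assoc)

lemma greedy_after_mono:
  assumes "greedy_after s y"
  shows "greedy_after (s' @ s) y"
  unfolding greedy_after_def
proof (intro allI impI notI)
  fix t d r c assume "y = t @ d # r" "c < d" "overlap_free ((s' @ s) @ t @ [c])"
  moreover have "sublist (s @ t @ [c]) ((s' @ s) @ t @ [c])" by (simp add: sublist_append)
  ultimately show False using assms overlap_free_sublist by (metis greedy_after_def)
qed

lemma greedy_after_singleton: "greedy_after s [d] \<longleftrightarrow> (\<forall>c<d. \<not> overlap_free (s @ [c]))"
  by (auto simp: greedy_after_def append_eq_Cons_conv Cons_eq_append_conv)

text \<open>The outer induction makes the inside of the blocks greedy; the inner one, downward in
  the first letter, handles everything after the first square. What remains is the letter
  \<open>Suc h\<close> following the square of \<open>rot k h\<close>.\<close>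

lemma greedy_suf: "l \<le> k \<Longrightarrow> greedy_after [l] (tl (suf k l))"
proof (induction k arbitrary: l)
  case 0
  then show ?case by (simp add: suf_self greedy_after_def)
next
  case (Suc k)
  have suf_Cons: "suf k i = i # tl (suf k i)" if "i \<le> k" for i
    using hd_suf[OF that] suf_nonempty by (metis list.collapse)
  \<comment> \<open>No letter is below the initial \<open>0\<close>, so \<open>suf k 0\<close> is
    greedy even with empty context, and hence after any word.\<close>
  have "greedy_after [] ([0] @ tl (suf k 0))"
    using Suc.IH[of 0] by (intro greedy_after_append) (simp_all add: greedy_after_singleton)
  then have "greedy_after [] (suf k 0)" using suf_Cons[of 0] by simp
  then have full: "greedy_after X (pre k i @ suf k i)" if "i \<le> k" for X i
    using greedy_after_mono[of "[]" "suf k 0" X] pre_suf[OF that] by simp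
  show ?case using Suc.prems
  proof (induction l rule: inc_induct)
    case base
    then show ?case by (simp add: suf_self greedy_after_def)
  next
    case (step h)
    then have h: "h \<le> k" by simp
    let ?r = "tl (suf k h)" and ?s = "suf (Suc k) (Suc h)"
    have s: "?s = Suc h # tl ?s"
      using hd_suf[of "Suc h" "Suc k"] h suf_nonempty[of "Suc k" "Suc h"]
      by (metis Suc_le_mono list.collapse)
    have "[h..<Suc k] = h # [Suc h..<Suc k]" using h by (simp add: upt_conv_Cons)
    then have "suf (Suc k) h = rot k h @ rot k h @ ?s"
      by (simp add: suf_def [of "Suc k"] gword_Suc)
    also have "\<dots> = h # ?r @ pre k h @ rot k h @ ?s"
      using suf_Cons[OF h] by (simp add: rot_def)
    finally have eq: "tl (suf (Suc k) h) = ?r @ pre k h @ suf k h @ pre k h @ [Suc h] @ tl ?s"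
      using s by (simp add: rot_def)
    \<comment> \<open>The letter \<open>h\<close> would restart the block after its square and
      complete an overlap. A smaller letter would follow \<open>pre k h\<close>, whose greedy
      continuation \<open>suf k h\<close> begins with \<open>h\<close>.\<close>
    have next_letter: "\<not> overlap_free (X @ rot k h @ rot k h @ [c])" if "c < Suc h" for c X
    proof
      assume of: "overlap_free (X @ rot k h @ rot k h @ [c])"
      show False
      proof (cases "c = h")
        case True
        have "hd (rot k h) = h" "rot k h \<noteq> []" using h by (simp_all add: rot_def suf_nonempty hd_suf)
        then show False using not_overlap_free_square_hd[of "rot k h"] True
            overlap_free_sublist[OF of sublist_append_leftI] by simp
      next
        case False
        have "greedy_after (pre k h) (suf k h)" using greedy_after_appendD2[OF full[OF h, of "[]"]] by simp
        then have "\<not> overlap_free (pre k h @ [] @ [c])"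
          using suf_Cons[OF h] False that unfolding greedy_after_def
          by (metis append_Nil less_antisym)
        moreover have "X @ rot k h @ rot k h @ [c] = (X @ rot k h @ suf k h) @ pre k h @ [c]"
          by (simp add: rot_def)
        ultimately show False
          using overlap_free_sublist[OF of] by (metis append_Nil sublist_append_leftI)
      qed
    qed
    have "greedy_after ([h] @ ?r @ pre k h @ suf k h @ pre k h) [Suc h]"
      unfolding greedy_after_singleton
    proof (intro allI impI)
      fix c assume "c < Suc h"
      from next_letter[OF this, of "[]"]
      show "\<not> overlap_free (([h] @ ?r @ pre k h @ suf k h @ pre k h) @ [c])"
        using suf_Cons[OF h] by (metis append.assoc append_Cons append_Nil rot_def)
    qed
    moreover have "greedy_after ([h] @ ?r @ pre k h @ suf k h @ pre k h @ [Suc h]) (tl ?s)"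
      using greedy_after_mono[OF step.IH, of "[h] @ ?r @ pre k h @ suf k h @ pre k h"] by simp
    moreover have "greedy_after X (pre k h)" for X using full[OF h] greedy_after_appendD1 by blast
    moreover have "greedy_after ([h] @ ?r) (pre k h @ suf k h)" using full[OF h] .
    then have "greedy_after ([h] @ ?r @ pre k h) (suf k h)" using greedy_after_appendD2 by fastforce
    ultimately show ?case using Suc.IH[OF h] unfolding eq
      by (intro greedy_after_append) simp_all
  qed
qed

section \<open>Overlap-freeness\<close>

text \<open>Each copy of a block contains \<open>k\<close> once, so an occurrence of
  \<open>k\<close> is given by an entry \<open>l\<close> and the choice of the first or the second
  copy in its square.\<close>

lemma gword_occurrence:
  assumes "gword (Suc k) A = X @ k # Y"
  obtains A1 l A2 where "A = A1 @ l # A2"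
    "X = squares k A1 @ butlast (suf k l)" "Y = pre k l @ rot k l @ gword (Suc k) A2"
  | A1 l A2 where "A = A1 @ l # A2"
    "X = squares k A1 @ rot k l @ butlast (suf k l)" "Y = pre k l @ gword (Suc k) A2"
proof -
  have fresh: "k \<notin> set (butlast (suf k l))" "k \<notin> set (pre k l)" for l
    using set_butlast_gword[of k] by (auto simp: suf_def pre_def)
  have "\<exists>A1 l A2. A = A1 @ l # A2 \<and>
      (X = squares k A1 @ butlast (suf k l) \<and> Y = pre k l @ rot k l @ gword (Suc k) A2 \<or>
       X = squares k A1 @ rot k l @ butlast (suf k l) \<and> Y = pre k l @ gword (Suc k) A2)"
    using assms
  proof (induction A arbitrary: X)
    case Nil
    then show ?case by (auto simp: gword_Suc Cons_eq_append_conv)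
  next
    case (Cons l A)
    let ?w = "butlast (suf k l)"
    have eq: "X @ k # Y = ?w @ k # pre k l @ rot k l @ gword (Suc k) A"
      using Cons.prems rot_eq[of k l] by (simp add: gword_Suc)
    consider "X = ?w" "Y = pre k l @ rot k l @ gword (Suc k) A"
      | X1 where "X = ?w @ k # X1" "pre k l @ rot k l @ gword (Suc k) A = X1 @ k # Y"
      using occurrence_cases[OF eq fresh(1)] by blast
    then show ?case
    proof cases
      case 1
      show ?thesis
        by (rule exI[of _ "[]"], rule exI[of _ l], rule exI[of _ A]) (simp add: 1)
    next
      case (2 X1)
      have eq: "X1 @ k # Y = (pre k l @ ?w) @ k # pre k l @ gword (Suc k) A"
        using 2(2) rot_eq[of k l] by simp
      have "k \<notin> set (pre k l @ ?w)" using fresh by simp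
      then consider "X1 = pre k l @ ?w" "Y = pre k l @ gword (Suc k) A"
        | X2 where "X1 = (pre k l @ ?w) @ k # X2" "pre k l @ gword (Suc k) A = X2 @ k # Y"
        using occurrence_cases[OF eq] by blast
      then show ?thesis
      proof cases
        case 1
        then show ?thesis using 2(1) rot_eq[of k l]
          by (intro exI[of _ "[]"], intro exI[of _ l], intro exI[of _ A]) simp
      next
        case (2 X2)
        obtain X3 where X3: "X2 = pre k l @ X3" "gword (Suc k) A = X3 @ k # Y"
          using 2(2) fresh(2)[of l] by (auto simp: append_eq_append_conv2 append_eq_Cons_conv)
        have X: "X = rot k l @ rot k l @ X3" using \<open>X = ?w @ k # X1\<close> 2(1) X3(1) rot_eq[of k l] by simp
        from Cons.IH[OF X3(2)] obtain A1 i A2 where "A = A1 @ i # A2"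
          "X3 = squares k A1 @ butlast (suf k i) \<and> Y = pre k i @ rot k i @ gword (Suc k) A2 \<or>
           X3 = squares k A1 @ rot k i @ butlast (suf k i) \<and> Y = pre k i @ gword (Suc k) A2"
          by blast
        then show ?thesis using X
          by (intro exI[of _ "l # A1"], intro exI[of _ i], intro exI[of _ A2]) auto
      qed
    qed
  qed
  then show thesis using that by blast
qed

text \<open>This is the word between the two occurrences of \<open>k\<close> in one square; it does
  not depend on \<open>l\<close>.\<close>

lemma pre_butlast_suf: "l \<le> k \<Longrightarrow> pre k l @ butlast (suf k l) = butlast (suf k 0)"
  by (metis butlast_append pre_suf suf_nonempty)

text \<open>Raising the index from \<open>l\<close> to \<open>l'\<close> moves the squares with
  indices in \<open>[l..<l']\<close> from the suffix to the prefix. The end letters of this stretch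
  \<open>s\<close> are what stops matches between different blocks.\<close>

lemma pre_suf_gap:
  assumes "l < l'" "l' \<le> k"
  obtains s where "s \<noteq> []" "pre k l' = pre k l @ s"
    "butlast (suf k l) = s @ butlast (suf k l')" "hd s = l" "last s = k - l'"
proof -
  obtain j where k: "k = Suc j" using assms by (cases k) auto
  let ?s = "squares j [l..<l']"
  have "[l..<l'] = l # [Suc l..<l']" using assms by (simp add: upt_conv_Cons)
  then have "?s = rot j l @ rot j l @ squares j [Suc l..<l']" by simp
  then have s: "?s \<noteq> []" "hd ?s = l"
    using assms k by (simp_all add: rot_def suf_nonempty hd_suf)
  have "[0..<l'] = [0..<l] @ [l..<l']" "[l..<k] = [l..<l'] @ [l'..<k]"
    using assms by (metis le_add_diff_inverse le0 less_imp_le upt_add_eq_append)+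
  then have eq: "pre k l' = pre k l @ ?s" "butlast (suf k l) = ?s @ butlast (suf k l')"
    by (simp_all add: k pre_Suc suf_def gword_Suc butlast_append del: upt_Suc)
  moreover have "last ?s = k - l'" using last_pre[OF assms(2)] eq(1) s(1) by simp
  ultimately show thesis using that s by blast
qed

lemma length_squares:
  "set A \<subseteq> {..k} \<Longrightarrow> length (squares k A) = 2 * length (suf k 0) * length A"
proof (induction A)
  case (Cons a A)
  then have "length (rot k a) = length (suf k 0)"
    using pre_suf[of a k] by (simp add: rot_def) (metis add.commute length_append)
  then show ?case using Cons by simp
qed simp

text \<open>An overlap through \<open>k\<close> would give equality here. On each side the two
  contexts share an explicit word and then disagree, because the entries of \<open>A\<close>
  increase; adding the lengths of the shared words leaves at least one letter missing.\<close>

lemma gword_match_short: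
  assumes A: "sorted_wrt (<) A" "set A \<subseteq> {..k}"
    and XY: "gword (Suc k) A = X @ k # Y" "gword (Suc k) A = X' @ k # Y'"
    and u: "suffix u X" "suffix u X'" and v: "prefix v Y" "prefix v Y'"
    and shorter: "length X < length X'"
  shows "length X + length u + length v < length X'"
proof -
  define w where "w = (\<lambda>l. butlast (suf k l))"
  define p where "p = pre k"
  define U where "U = squares k"
  define V where "V = gword (Suc k)"
  define n where "n = length (suf k 0)"
  have R: "rot k l = w l @ k # p l" for l by (simp add: rot_eq w_def p_def)
  have pw: "p l @ w l = w 0" if "l \<le> k" for l
    using pre_butlast_suf[OF that] by (simp add: p_def w_def)
  have n: "n = Suc (length (w 0))"
    unfolding n_def w_def by (metis length_append_singleton suf_snoc)
  have len_pw: "length (p l) + length (w l) + 1 = n" if "l \<le> k" for l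
    using pw[OF that] n by (metis Suc_eq_plus1 length_append)
  have len_U: "length (U B) = 2 * n * length B" if "set B \<subseteq> {..k}" for B
    using length_squares[OF that] by (simp add: U_def n_def)
  \<comment> \<open>Entries before \<open>l\<close> are smaller, so the preceding block ends with a
    letter above \<open>k - l\<close>.\<close>
  have last_U: "U B = [] \<or> last (U B) \<noteq> k - l" if "A = B @ l # C" for B l C
  proof (cases "B = []")
    case False
    then have "last B < l" using A(1) that by (simp add: sorted_wrt_append)
    then show ?thesis using False A(2) that last_squares[of B k] by (auto simp: U_def)
  qed (simp add: U_def)
  \<comment> \<open>The continuation starts with a later entry or, if there is none, with the final
    \<open>Suc k\<close>.\<close>
  have hd_V: "l < hd (V C)" if "A = B @ l # C" for B l C
  proof -
    have "set C \<subseteq> {..k}" "l \<le> k" using A(2) that by auto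
    then show ?thesis using A(1) that hd_gword_Suc[of C k]
      by (cases C) (auto simp: V_def sorted_wrt_append)
  qed
  have last_p: "last (k # p l) = k - l" if "l \<le> k" for l
    using last_pre[OF that] by (simp add: p_def)
  \<comment> \<open>For \<open>l = k\<close> the word \<open>w l\<close> is empty and the first
    letter is the displayed \<open>k\<close>.\<close>
  have hd_w: "hd (w l @ k # x) = l" if "l \<le> k" for l x
    using hd_suf[OF that] suf_snoc[of k l] unfolding w_def
    by (metis append.assoc append_Cons append_Nil hd_append2 snoc_eq_iff_butlast)
  have gap: "\<exists>s. s \<noteq> [] \<and> p l' = p l @ s \<and> w l = s @ w l' \<and> hd s = l \<and> last s = k - l'"
    if "l < l'" "l' \<le> k" for l l'
    using pre_suf_gap[OF that] unfolding p_def w_def by metis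
  \<comment> \<open>The flag \<open>t\<close> says that the occurrence lies in the second copy of
    the square.\<close>
  have occ: "\<exists>B l C t. A = B @ l # C \<and> X = U B @ (if t then rot k l else []) @ w l
      \<and> Y = p l @ (if t then [] else rot k l) @ V C"
    if "gword (Suc k) A = X @ k # Y" for X Y
    using that
  proof (cases rule: gword_occurrence)
    case (1 B l C)
    then show ?thesis by (intro exI[of _ B], intro exI[of _ l], intro exI[of _ C], intro exI[of _ False])
        (simp add: U_def V_def w_def p_def)
  next
    case (2 B l C)
    then show ?thesis by (intro exI[of _ B], intro exI[of _ l], intro exI[of _ C], intro exI[of _ True])
        (simp add: U_def V_def w_def p_def)
  qed
  obtain B l C t where 1: "A = B @ l # C" "X = U B @ (if t then rot k l else []) @ w l"
    "Y = p l @ (if t then [] else rot k l) @ V C" using occ[OF XY(1)] by blast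
  obtain B' l' C' t' where 2: "A = B' @ l' # C'"
    "X' = U B' @ (if t' then rot k l' else []) @ w l'"
    "Y' = p l' @ (if t' then [] else rot k l') @ V C'" using occ[OF XY(2)] by blast
  have l: "l \<le> k" "l' \<le> k" "set B \<subseteq> {..k}" "set B' \<subseteq> {..k}"
    using A(2)[unfolded 1(1)] A(2)[unfolded 2(1)] by simp_all
  have len_R: "length (rot k i) = n" if "i \<le> k" for i using len_pw[OF that] R by simp
  have len_X: "length X = 2 * n * length B + (if t then n else 0) + length (w l)"
    "length X' = 2 * n * length B' + (if t' then n else 0) + length (w l')"
    using 1(2) 2(2) len_U l len_R by simp_all
  note last_U1 = last_U[OF 1(1)] and last_U2 = last_U[OF 2(1)]
  note hd_V1 = hd_V[OF 1(1)] and hd_V2 = hd_V[OF 2(1)]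
  consider (same) "B = B'" "l = l'" "C = C'" | (less) M where "B' = B @ l # M"
    | (greater) M where "B = B' @ l' # M"
    using 1(1) 2(1) by (auto simp: append_eq_append_conv2 append_eq_Cons_conv Cons_eq_append_conv)
  then show ?thesis
  proof cases
    case same
    \<comment> \<open>Both occurrences lie in one square, at distance \<open>n\<close>, while the
      matches cover at most \<open>length (w l) + length (p l) = n - 1\<close> letters.\<close>
    then have t: "\<not> t" "t'" using shorter len_X by (auto split: if_splits)
    have "suffix u (U B @ w l)" "suffix u ((U B @ w l @ k # p l) @ w l)"
      using u 1 2 same t R by simp_all
    then have "length u \<le> length (w l)"
      by (rule common_suffix_le) (use last_U1 last_p[OF l(1)] in auto)
    moreover have "prefix v (p l @ w l @ k # p l @ V C)" "prefix v (p l @ V C)"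
      using v 1 2 same t R by simp_all
    then have "length v \<le> length (p l)"
      by (rule common_prefix_le) (use hd_V1 hd_w[OF l(1)] in auto)
    ultimately show ?thesis using len_X same t len_pw[OF l(1)] by simp
  next
    case (less M)
    then have "l < l'" using A(1) 2(1) by (simp add: sorted_wrt_append)
    then obtain s where s: "s \<noteq> []" "p l' = p l @ s" "w l = s @ w l'" "hd s = l" "last s = k - l'"
      using gap l(2) by blast
    have len_B: "2 * n * length B' \<ge> 2 * n * length B + 2 * n" using less by (simp add: algebra_simps)
    show ?thesis
    \<comment> \<open>If the occurrences lie in corresponding copies, one match runs through a
      further \<open>k\<close> and the common word \<open>w 0\<close>, which costs \<open>n\<close>
      letters. The distance is then at least \<open>2 * n - length s\<close>, and this still
      suffices.\<close>
    proof (cases t; cases t')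
      assume t: "t" "t'"
      have "suffix u ((U B @ s) @ w l' @ k # w 0)" "suffix u (U B' @ w l' @ k # w 0)"
        using u 1(2) 2(2) t R pw[OF l(1)] pw[OF l(2)] s(3) by simp_all
      then have "length u \<le> length (w l' @ k # w 0)"
        by (rule common_suffix_le) (use last_U2 s in auto)
      moreover have "prefix v (p l @ V C)" "prefix v (p l @ s @ V C')"
        using v 1(3) 2(3) t s by simp_all
      then have "length v \<le> length (p l)"
        by (rule common_prefix_le) (use hd_V1 s in auto)
      ultimately show ?thesis using len_X t len_pw[OF l(1)] len_B n by simp
    next
      assume t: "t" "\<not> t'"
      have "suffix u ((U B @ w l @ k # p l') @ w l')" "suffix u (U B' @ w l')"
        using u 1(2) 2(2) t R s by simp_all
      then have "length u \<le> length (w l')"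
        by (rule common_suffix_le) (use last_U2 last_p[OF l(2)] in auto)
      moreover have "prefix v (p l @ V C)" "prefix v (p l @ w l @ k # p l' @ V C')"
        using v 1(3) 2(3) t R s by simp_all
      then have "length v \<le> length (p l)"
        by (rule common_prefix_le) (use hd_V1 hd_w[OF l(1)] in auto)
      ultimately show ?thesis using len_X t len_pw[OF l(1)] len_B n by simp
    next
      assume t: "\<not> t" "t'"
      have "suffix u (U B @ w l)" "suffix u ((U B' @ w l' @ k # p l) @ w l)"
        using u 1(2) 2(2) t R s by simp_all
      then have "length u \<le> length (w l)"
        by (rule common_suffix_le) (use last_U1 last_p[OF l(1)] in auto)
      moreover have "prefix v (p l' @ w l' @ k # p l @ V C)" "prefix v (p l' @ V C')"
        using v 1(3) 2(3) t R s by simp_all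
      then have "length v \<le> length (p l')"
        by (rule common_prefix_le) (use hd_V2 hd_w[OF l(2)] in auto)
      ultimately show ?thesis using len_X t len_pw[OF l(1)] len_pw[OF l(2)] len_B n by simp
    next
      assume t: "\<not> t" "\<not> t'"
      have "suffix u ((U B @ s) @ w l')" "suffix u (U B' @ w l')"
        using u 1(2) 2(2) t R s by simp_all
      then have "length u \<le> length (w l')"
        by (rule common_suffix_le) (use last_U2 s in auto)
      moreover have "prefix v ((w 0 @ k # p l) @ V C)" "prefix v ((w 0 @ k # p l) @ s @ V C')"
        using v 1(3) 2(3) t R s(2) pw[OF l(1), symmetric] s(3) by simp_all
      then have "length v \<le> length (w 0 @ k # p l)"
        by (rule common_prefix_le) (use hd_V1 s in auto)
      ultimately show ?thesis using len_X t len_pw[OF l(1)] len_B n by simp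
    qed
  next
    case (greater M)
    \<comment> \<open>A later square would make \<open>X\<close> longer than \<open>X'\<close>,
      against \<open>shorter\<close>.\<close>
    then have "2 * n * length B \<ge> 2 * n * length B' + 2 * n" by (simp add: algebra_simps)
    then show ?thesis using shorter len_X len_pw[OF l(1)] len_pw[OF l(2)] by (simp split: if_splits)
  qed
qed

text \<open>The induction on \<open>A\<close> carries along the part \<open>pre k l\<close> left
  over from the previous block. Cutting at \<open>k\<close> leaves pieces
  \<open>pre k j @ butlast (suf k a)\<close> with \<open>j <= a\<close>, which are factors of
  \<open>gword k ([0..<j] @ [a..<k])\<close>, and a last piece closed by the fresh letter
  \<open>Suc k\<close>.\<close>

lemma overlap_free_gword_avoiding:
  assumes IH: "\<And>A. sorted_wrt (<) A \<Longrightarrow> set A \<subseteq> {..<k} \<Longrightarrow> overlap_free (gword k A)"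
    and "k \<notin> set u" "sorted_wrt (<) A" "set A \<subseteq> {..k}" "l \<le> k" "\<And>a. a \<in> set A \<Longrightarrow> l \<le> a"
    and "sublist u (pre k l @ gword (Suc k) A)"
  shows "overlap_free u"
  using assms(3-)
proof (induction A arbitrary: l)
  case Nil
  have "overlap_free (butlast (gword k [0..<l]) @ [Suc k])"
  proof (rule overlap_free_snoc_fresh)
    have "overlap_free (gword k [0..<l])" using Nil.prems(3) by (intro IH) auto
    then show "overlap_free (butlast (gword k [0..<l]))"
      by (rule overlap_free_sublist) (intro prefix_imp_sublist prefixeq_butlast)
    show "Suc k \<notin> set (butlast (gword k [0..<l]))" using set_butlast_gword[of k "[0..<l]"] by auto
  qed
  then show ?case using Nil.prems(5) overlap_free_sublist by (simp add: gword_Suc pre_def)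
next
  case (Cons a A)
  let ?w = "butlast (suf k a)"
  have a: "a \<le> k" "l \<le> a" using Cons.prems by auto
  \<comment> \<open>Here \<open>j = l\<close> is the passage from the leftover part into the square
    of \<open>a\<close>, and \<open>j = a\<close> the passage between its two copies.\<close>
  have between: "overlap_free (pre k j @ ?w)" if "j \<le> a" for j
  proof (rule overlap_free_sublist)
    show "overlap_free (gword k ([0..<j] @ [a..<k]))"
      using that a by (intro IH) (auto simp: sorted_wrt_append)
    have "gword k ([0..<j] @ [a..<k]) = pre k j @ suf k a"
      using that a by (simp add: pre_append_gword suf_def)
    also have "\<dots> = (pre k j @ ?w) @ [k]" using suf_snoc by simp
    finally show "sublist (pre k j @ ?w) (gword k ([0..<j] @ [a..<k]))"
      by (metis prefixI prefix_imp_sublist)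
  qed
  have "pre k l @ gword (Suc k) (a # A) =
      (pre k l @ ?w) @ k # (pre k a @ ?w) @ k # pre k a @ gword (Suc k) A"
    by (simp add: gword_Suc rot_eq)
  then consider "sublist u (pre k l @ ?w)" | "sublist u (pre k a @ ?w)"
    | "sublist u (pre k a @ gword (Suc k) A)"
    using sublist_avoiding assms(2) Cons.prems(5) by metis
  then show ?case
  proof cases
    case 3
    then show ?thesis using Cons.prems a by (intro Cons.IH[of a]) auto
  qed (use between a overlap_free_sublist in blast)+
qed

lemma overlap_free_gword:
  "sorted_wrt (<) A \<Longrightarrow> set A \<subseteq> {..<k} \<Longrightarrow> overlap_free (gword k A)"
proof (induction k arbitrary: A)
  case 0
  have "\<not> is_overlap u" if "sublist u [0 :: nat]" for u
    using sublist_length_le[OF that] by (auto simp: is_overlap_def)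
  then show ?case by (simp add: overlap_free_def)
next
  case (Suc k)
  then have A: "set A \<subseteq> {..k}" by auto
  show ?case unfolding overlap_free_def
  proof clarify
    fix w assume w: "sublist w (gword (Suc k) A)" "is_overlap w"
    show False
    proof (cases "k \<in> set w")
      case True
      obtain X Y X' Y' u v where
        "gword (Suc k) A = X @ k # Y" "gword (Suc k) A = X' @ k # Y'"
        "suffix u X" "suffix u X'" "prefix v Y" "prefix v Y'" "length X < length X'"
        and len: "length X' = length X + length u + length v"
        by (rule overlap_matches_occurrences[OF w True])
      from gword_match_short[OF Suc.prems(1) A this(1-7)] len show False by simp
    next
      case False
      \<comment> \<open>With \<open>l = 0\<close> the leftover part is empty.\<close>
      have "overlap_free w"
        by (rule overlap_free_gword_avoiding[OF Suc.IH False Suc.prems(1) A, of 0]) (use w in auto)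
      then show False using w(2) by (auto simp: overlap_free_def)
    qed
  qed
qed

section \<open>The least word\<close>

text \<open>Exhibiting the least element settles its existence as well. A smaller competitor would
  be a proper prefix or would lower a letter.\<close>

lemma psi_eq_suf:
  assumes "h \<le> k"
  shows "psi h k = suf k h"
  unfolding psi_def
proof (rule Least_equality)
  have "overlap_free (suf k h)" unfolding suf_def by (rule overlap_free_gword) auto
  then show "overlap_free (suf k h) \<and> suf k h \<noteq> [] \<and> hd (suf k h) = h \<and> last (suf k h) = k"
    using assms suf_nonempty hd_suf suf_snoc by (metis last_snoc)
next
  fix y assume y: "overlap_free y \<and> y \<noteq> [] \<and> hd y = h \<and> last y = k"
  show "suf k h \<le> y"
  proof (rule ccontr)
    assume "\<not> suf k h \<le> y"
    then have "y < suf k h" by simp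
    then have "(y, suf k h) \<in> lexord {(u, v). u < v}" by (simp add: list_less_def)
    then consider a z where "suf k h = y @ a # z"
      | t c d y' z where "c < d" "y = t @ c # y'" "suf k h = t @ d # z"
      by (auto simp: lexord_def)
    then show False
    proof cases
      case 1
      \<comment> \<open>A proper prefix ending in \<open>k\<close> would put \<open>k\<close> before
        the last position.\<close>
      then have "k \<in> set (butlast (suf k h))" using y
        by (metis append_is_Nil_conv butlast_append in_set_conv_decomp last_in_set
            list.distinct(1) Un_iff set_append)
      then show False using set_butlast_gword[of k "[h..<k]"] by (auto simp: suf_def)
    next
      case 2
      \<comment> \<open>Both words start with \<open>h\<close>, so they first differ after that
        letter, where greediness applies.\<close>
      then obtain t' where t: "t = h # t'"
        using y hd_suf[OF assms] by (cases t) auto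
      then have "tl (suf k h) = t' @ d # z" using 2 by simp
      then have "\<not> overlap_free ([h] @ t' @ [c])"
        using greedy_suf[OF assms] 2(1) unfolding greedy_after_def by blast
      moreover have "prefix ([h] @ t' @ [c]) y" using 2 t by simp
      ultimately show False using y overlap_free_sublist prefix_imp_sublist by blast
    qed
  qed
qed

lemma shift_inv_funpow_append: "(shift_inv ^^ length v) (u @ v) = v @ u"
proof (induction v arbitrary: u rule: rev_induct)
  case (snoc c v)
  have "(shift_inv ^^ length (v @ [c])) (u @ v @ [c]) = (shift_inv ^^ length v) ((c # u) @ v)"
    using shift_inv_snoc[of "u @ v" c] by (simp add: funpow_Suc_right del: funpow.simps)
  then show ?case using snoc.IH[of "c # u"] by simp
qed simp

theorem theorem10:
  fixes h k :: nat
  assumes "0 \<le> h" and "h \<le> k"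
  shows "psi h k =
    concat (map (\<lambda>l. square ((shift_inv ^^ psi_length l (k - 1)) (psi 0 (k - 1)))) [h..<k]) @ [k]"
proof (cases k)
  case 0
  then show ?thesis using assms by (simp add: psi_eq_suf suf_self)
next
  case (Suc j)
  \<comment> \<open>Since \<open>psi 0 j\<close> is \<open>pre j l @ suf j l\<close>, shifting back
    by the length of \<open>suf j l\<close> brings that suffix to the front.\<close>
  have "(shift_inv ^^ psi_length l (k - 1)) (psi 0 (k - 1)) = rot j l" if "l \<in> set [h..<k]" for l
  proof -
    have l: "l \<le> j" using that Suc by auto
    then show ?thesis
      using shift_inv_funpow_append[of "suf j l" "pre j l"]
      by (simp add: Suc psi_length_def psi_eq_suf pre_suf rot_def)
  qed
  then have "map (\<lambda>l. square ((shift_inv ^^ psi_length l (k - 1)) (psi 0 (k - 1)))) [h..<k]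
      = map (\<lambda>l. square (rot j l)) [h..<k]" by (intro map_cong) simp_all
  moreover have "psi h k = concat (map (\<lambda>l. square (rot j l)) [h..<k]) @ [k]"
    using psi_eq_suf[OF assms(2)] by (simp add: suf_def Suc gword_Suc squares_def del: upt_Suc)
  ultimately show ?thesis by (simp only:)
qed

end
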